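(* Let $G$ be a graph and $Y_G\subseteq V(G)$ a blocking set in $G$. Then there is a blocking set $Y'_G\subseteq Y_G$ in $G$ of size at most $2^{{\sf bd}(G)}$.
   Context: All graphs are finite, undirected, simple. $\alpha(G)$ is the independence number; $Y\subseteq V(G)$ is a blocking set in $G$ if $\alpha(G\setminus Y)<\alpha(G)$. Bridge-depth: an edge is a bridge if its removal increases the number of connected components; $\bar G$ is obtained from $G$ by contracting all bridges; ${\sf bd}(G)=0$ for the empty graph, the maximum over components for disconnected $G$, and $1+\min_{v\in V(\bar G)}{\sf bd}(\bar G\setminus v)$ for connected nonempty $G$. *)

theory Defs
  imports "Graph_Theory.Graph_Theory"
begin

text \<open>
  A finite simple undirected graph is a \<^locale>\<open>pair_graph\<close>: a finite, symmetric, loop-free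
  digraph without parallel arcs. An undirected edge \<open>uv\<close> is the pair of arcs \<open>(u,v)\<close>, \<open>(v,u)\<close>.
\<close>

definition pair_induce :: "'a pair_pre_digraph \<Rightarrow> 'a set \<Rightarrow> 'a pair_pre_digraph" where
  "pair_induce G S = \<lparr>pverts = S, parcs = {(u, v) \<in> parcs G. u \<in> S \<and> v \<in> S}\<rparr>"

definition pair_del_verts :: "'a pair_pre_digraph \<Rightarrow> 'a set \<Rightarrow> 'a pair_pre_digraph" where
  "pair_del_verts G Y = pair_induce G (pverts G - Y)"

definition pair_del_edge :: "'a pair_pre_digraph \<Rightarrow> 'a \<Rightarrow> 'a \<Rightarrow> 'a pair_pre_digraph" where
  "pair_del_edge G u v = \<lparr>pverts = pverts G, parcs = parcs G - {(u, v), (v, u)}\<rparr>"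

lemma with_proj_pair_induce: "with_proj (pair_induce G S) = with_proj G \<restriction> S"
  by (auto simp: pair_induce_def induce_subgraph_def with_proj_def)


definition independent_set :: "'a pair_pre_digraph \<Rightarrow> 'a set \<Rightarrow> bool" where
  "independent_set G S \<longleftrightarrow> S \<subseteq> pverts G \<and> (\<forall>u \<in> S. \<forall>v \<in> S. (u, v) \<notin> parcs G)"

definition independence_number :: "'a pair_pre_digraph \<Rightarrow> nat" where
  "independence_number G = Max (card ` {S. independent_set G S})"

definition blocking_set :: "'a pair_pre_digraph \<Rightarrow> 'a set \<Rightarrow> bool" where
  "blocking_set G Y \<longleftrightarrow>
     Y \<subseteq> pverts G \<and> independence_number (pair_del_verts G Y) < independence_number G"


text \<open>For symmetric digraphs the strongly connected components are the connected components.\<close>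

abbreviation components :: "'a pair_pre_digraph \<Rightarrow> 'a set set" where
  "components G \<equiv> pre_digraph.sccs_verts (with_proj G)"

definition bridge :: "'a pair_pre_digraph \<Rightarrow> 'a \<Rightarrow> 'a \<Rightarrow> bool" where
  "bridge G u v \<longleftrightarrow>
     (u, v) \<in> parcs G \<and> card (components G) < card (components (pair_del_edge G u v))"

definition bridge_graph :: "'a pair_pre_digraph \<Rightarrow> 'a pair_pre_digraph" where
  "bridge_graph G = \<lparr>pverts = pverts G, parcs = {(u, v). bridge G u v}\<rparr>"

text \<open>
  Contracting all bridges identifies two vertices iff they are joined by a walk of bridges.
  The vertex that results from a class is named by a chosen element of that class rather than by
  the class itself, so that the vertex type does not change and \<open>bd\<close> below can recurse.
  Loops are dropped. Parallel edges cannot arise: two distinct edges between two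
  classes would lie on a common cycle with the bridges joining their ends.
\<close>

definition bridge_rep :: "'a pair_pre_digraph \<Rightarrow> 'a \<Rightarrow> 'a" where
  "bridge_rep G u = (SOME v. v \<in> pre_digraph.scc_of (with_proj (bridge_graph G)) u)"

definition contract_bridges :: "'a pair_pre_digraph \<Rightarrow> 'a pair_pre_digraph" where
  "contract_bridges G =
     \<lparr>pverts = bridge_rep G ` pverts G,
      parcs = {(bridge_rep G u, bridge_rep G v) | u v.
                 (u, v) \<in> parcs G \<and> bridge_rep G u \<noteq> bridge_rep G v}\<rparr>"


lemma pair_graph_pair_induce:
  assumes "pair_graph G" "S \<subseteq> pverts G"
  shows "pair_graph (pair_induce G S)"
proof -
  interpret pair_graph G by fact
  have "finite S" using assms(2) pair_finite_verts finite_subset by blast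
  moreover have "finite {(u, v) \<in> parcs G. u \<in> S \<and> v \<in> S}"
    using pair_finite_arcs by (rule finite_subset[rotated]) auto
  ultimately show ?thesis
    by unfold_locales
      (auto simp: pair_induce_def symmetric_def sym_def dest: arcs_symmetric no_loops')
qed

lemma pair_graph_bridge_graph:
  assumes "pair_graph G"
  shows "pair_graph (bridge_graph G)"
proof -
  interpret pair_graph G by fact
  have fin: "finite {(u, v). bridge G u v}"
    using pair_finite_arcs by (rule finite_subset[rotated]) (auto simp: bridge_def)
  have "bridge G v u" if "bridge G u v" for u v
    using that by (auto simp: bridge_def pair_del_edge_def insert_commute intro: arcs_symmetric)
  then have "symmetric (with_proj (bridge_graph G))"
    by (auto simp: bridge_graph_def symmetric_def sym_def)
  moreover have "u \<in> pverts G" "v \<in> pverts G" "u \<noteq> v" if "bridge G u v" for u v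
    using that by (auto simp: bridge_def dest: in_arcsD1 in_arcsD2 no_loops')
  ultimately show ?thesis
    using pair_finite_verts fin
    by unfold_locales (auto simp: bridge_graph_def)
qed

lemma pair_graph_contract_bridges:
  assumes "pair_graph G"
  shows "pair_graph (contract_bridges G)"
proof -
  interpret pair_graph G by fact
  have "finite (parcs (contract_bridges G))"
    by (rule finite_subset[of _ "(\<lambda>(u, v). (bridge_rep G u, bridge_rep G v)) ` parcs G"])
      (auto simp: contract_bridges_def pair_finite_arcs)
  moreover have "symmetric (with_proj (contract_bridges G))"
    unfolding symmetric_def sym_def by (simp add: contract_bridges_def) (metis arcs_symmetric)
  ultimately show ?thesis
    using pair_finite_verts
    by unfold_locales (auto simp: contract_bridges_def dest: in_arcsD1 in_arcsD2)
qed

lemma bridge_rep_eq_iff: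
  assumes "pair_graph G" "u \<in> pverts G" "v \<in> pverts G"
  shows "bridge_rep G u = bridge_rep G v \<longleftrightarrow> u \<rightarrow>\<^sup>*\<^bsub>with_proj (bridge_graph G)\<^esub> v"
proof -
  interpret B: pair_graph "bridge_graph G"
    using assms(1) by (rule pair_graph_bridge_graph)
  have V: "pverts (bridge_graph G) = pverts G" by (simp add: bridge_graph_def)
  have rep: "bridge_rep G w \<in> B.scc_of w" if "w \<in> pverts G" for w
    unfolding bridge_rep_def
    by (rule someI[of _ w]) (use that in \<open>simp add: B.scc_of_def V\<close>)
  show ?thesis
  proof
    assume "bridge_rep G u = bridge_rep G v"
    with rep[OF assms(2)] rep[OF assms(3)]
    show "u \<rightarrow>\<^sup>*\<^bsub>with_proj (bridge_graph G)\<^esub> v"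
      by (auto simp: B.scc_of_def intro: B.reachable_trans)
  next
    assume uv: "u \<rightarrow>\<^sup>*\<^bsub>with_proj (bridge_graph G)\<^esub> v"
    then have "v \<rightarrow>\<^sup>*\<^bsub>with_proj (bridge_graph G)\<^esub> u"
      by (rule B.symmetric_reachable')
    with uv have "B.scc_of u = B.scc_of v"
      by (auto simp: B.scc_of_def intro: B.reachable_trans)
    then show "bridge_rep G u = bridge_rep G v" by (simp add: bridge_rep_def)
  qed
qed

lemma component_psubset:
  assumes "pair_graph G" "\<not> connected (with_proj G)" "S \<in> components G"
  shows "S \<subset> pverts G"
proof -
  interpret pair_graph G by fact
  have S: "S \<noteq> {}" "\<forall>u \<in> S. \<forall>v \<in> S. u \<rightarrow>\<^sup>*\<^bsub>with_proj G\<^esub> v"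
    using assms(3) by (auto simp: sccs_verts_def)
  then have "S \<subseteq> pverts G"
    using reachable_in_verts by blast
  moreover have "S \<noteq> pverts G"
  proof
    assume "S = pverts G"
    with S have "strongly_connected (with_proj G)"
      by (auto simp: strongly_connected_def)
    then have "connected (with_proj G)"
      by (simp add: connected_def strongly_connected_def reachable_mk_symmetric_eq sym_arcs)
    then show False using assms(2) by simp
  qed
  ultimately show ?thesis by blast
qed

lemma card_contract_bridges_del_vert:
  assumes "pair_graph G" "v \<in> pverts (contract_bridges G)"
  shows "card (pverts (pair_del_verts (contract_bridges G) {v})) < card (pverts G)"
proof -
  interpret pair_graph G by fact
  have "card (pverts (contract_bridges G) - {v}) < card (pverts (contract_bridges G))"
    using assms(2) pair_finite_verts
    by (intro psubset_card_mono) (auto simp: contract_bridges_def)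
  also have "\<dots> \<le> card (pverts G)"
    using card_image_le[OF pair_finite_verts] by (simp add: contract_bridges_def)
  finally show ?thesis by (simp add: pair_del_verts_def pair_induce_def)
qed


text \<open>The value outside \<^locale>\<open>pair_graph\<close> is irrelevant.\<close>

function bd :: "'a pair_pre_digraph \<Rightarrow> nat" where
  "bd G =
    (if \<not> pair_graph G \<or> pverts G = {} then 0
     else if connected (with_proj G) then
       1 + Min ((\<lambda>v. bd (pair_del_verts (contract_bridges G) {v})) ` pverts (contract_bridges G))
     else Max ((\<lambda>S. bd (pair_induce G S)) ` components G))"
  by auto
termination
proof (relation "measure (\<lambda>G. card (pverts G))", goal_cases)
  case 1
  show ?case by simp
next
  case (2 G v)
  then show ?case by (auto intro: card_contract_bridges_del_vert)
next
  case (3 G S)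
  then have G: "pair_graph G" and "S \<subset> pverts G" using component_psubset by auto
  moreover from G have "finite (pverts G)"
    using pair_fin_digraph.pair_finite_verts pair_graph_def pair_digraph_def by blast
  ultimately show ?case by (auto simp: pair_induce_def intro: psubset_card_mono)
qed

declare bd.simps[simp del]

end

theory Submission
  imports Defs
begin

text \<open>
  Fix a vertex \<open>v\<close> of the contraction of a connected \<open>G\<close> and let \<open>T\<close> be the tree of bridges that is
  contracted to \<open>v\<close>. The subgraph on \<open>T\<close> is bipartite, and each component of \<open>G - T\<close> is attached to
  at most one vertex of \<open>T\<close>, so \<open>V(G)\<close> splits into bags, one around each \<open>t \<in> T\<close>, with no edges
  between bags except those inside \<open>T\<close>. Record for a maximum independent set which vertices of \<open>T\<close> it
  uses, with the answer negated on one colour class of \<open>T\<close>. The resulting bit vectors form a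
  distributive lattice, since recombining two maximum independent sets bag by bag gives two
  independent sets of the same total size. In such a lattice, one-coordinate constraints that are
  pairwise satisfiable are jointly satisfiable. A set \<open>Y\<close> that meets all maximum independent sets
  forbids certain states of certain bags (it meets every maximum independent set in this state
  inside the bag), and the forbidden states cannot be avoided simultaneously. So two of them already
  cannot, and each of the two is forbidden by at most \<open>2\<^sup>d\<close> elements of \<open>Y\<close>, by induction on the
  graph \<open>G - T\<close>, whose bridge-depth is \<open>d\<close>.
\<close>

section \<open>Layered graphs\<close>

text \<open>Subgraphs are given by a vertex set and the fixed arc relation \<open>E\<close>, so the
  inductions pass to induced subgraphs just by shrinking the set.\<close>

definition indep :: "('a \<times> 'a) set \<Rightarrow> 'a set \<Rightarrow> bool" where
  "indep E S \<longleftrightarrow> (\<forall>u \<in> S. \<forall>v \<in> S. (u, v) \<notin> E)"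

definition max_indep :: "('a \<times> 'a) set \<Rightarrow> 'a set \<Rightarrow> 'a set \<Rightarrow> bool" where
  "max_indep E V S \<longleftrightarrow>
     S \<subseteq> V \<and> indep E S \<and> (\<forall>R. R \<subseteq> V \<longrightarrow> indep E R \<longrightarrow> card R \<le> card S)"

definition hits :: "('a \<times> 'a) set \<Rightarrow> 'a set \<Rightarrow> 'a set \<Rightarrow> bool" where
  "hits E V Y \<longleftrightarrow> (\<forall>S. max_indep E V S \<longrightarrow> S \<inter> Y \<noteq> {})"

text \<open>
  \<open>T\<close> is the set of top-level vertices, \<open>c\<close> colours it properly, and \<open>g\<close> maps each vertex to the name
  of its bag. Unlike bridge-depth, this notion is obviously inherited by subsets of vertices.
\<close>

fun layered :: "('a \<times> 'a) set \<Rightarrow> nat \<Rightarrow> 'a set \<Rightarrow> bool" where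
  "layered E 0 V \<longleftrightarrow> V = {}"
| "layered E (Suc d) V \<longleftrightarrow>
     (\<exists>T \<subseteq> V. \<exists>(c :: 'a \<Rightarrow> bool) (g :: 'a \<Rightarrow> 'a). (\<forall>t \<in> T. g t = t) \<and>
        (\<forall>u \<in> V. \<forall>v \<in> V. (u, v) \<in> E \<longrightarrow> g u = g v \<or> u \<in> T \<and> v \<in> T \<and> c u \<noteq> c v) \<and>
        layered E d (V - T))"

lemma layered_subset: "layered E d V \<Longrightarrow> W \<subseteq> V \<Longrightarrow> layered E d W"
proof (induction d arbitrary: V W)
  case (Suc d)
  then obtain T c g where *: "T \<subseteq> V" "\<forall>t \<in> T. g t = t" "layered E d (V - T)"
    "\<forall>u \<in> V. \<forall>v \<in> V. (u, v) \<in> E \<longrightarrow> g u = g v \<or> u \<in> T \<and> v \<in> T \<and> c u \<noteq> (c v :: bool)"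
    by auto
  have "layered E d (W - T \<inter> W)"
    using Suc.prems(2) by (intro Suc.IH[OF *(3)]) auto
  moreover have "\<forall>u \<in> W. \<forall>v \<in> W. (u, v) \<in> E \<longrightarrow>
      g u = g v \<or> u \<in> T \<inter> W \<and> v \<in> T \<inter> W \<and> c u \<noteq> c v"
    using *(4) Suc.prems(2) by blast
  ultimately show ?case
    using *(2) unfolding layered.simps
    by (intro exI[of _ "T \<inter> W"] exI[of _ c] exI[of _ g] conjI) auto
qed auto

lemma layered_Suc: "layered E d V \<Longrightarrow> layered E (Suc d) V"
  unfolding layered.simps
  by (intro exI[of _ "{}"] exI[of _ "\<lambda>_. True"] exI[of _ "\<lambda>_. undefined"] conjI) auto

lemma layered_mono: "layered E d V \<Longrightarrow> d \<le> e \<Longrightarrow> layered E e V"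
  by (rule lift_Suc_mono_le[of "\<lambda>d. layered E d V", unfolded le_bool_def, rule_format])
     (auto intro: layered_Suc simp del: layered.simps)

text \<open>No edge joins two classes, so \<open>T\<close>, \<open>c\<close> and \<open>g\<close>
  chosen per class can be glued. Bag names of different classes may coincide: this only fuses bags,
  and each bag still has at most one top-level vertex because \<open>g\<close> fixes
  \<open>T\<close> pointwise.\<close>

lemma layered_classes:
  assumes "\<And>w. w \<in> W \<Longrightarrow> layered E d {x \<in> W. k x = k w}"
    and "\<And>u v. u \<in> W \<Longrightarrow> v \<in> W \<Longrightarrow> (u, v) \<in> E \<Longrightarrow> k u = k v"
  shows "layered E d W"
  using assms
proof (induction d arbitrary: W)
  case 0
  have "w \<notin> W" for w using 0(1)[of w] by auto
  then show ?case by auto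
next
  case (Suc d)
  let ?C = "\<lambda>w. {x \<in> W. k x = w}"
  let ?P = "\<lambda>w T c g. T \<subseteq> ?C w \<and> (\<forall>t \<in> T. g t = t) \<and>
    (\<forall>u \<in> ?C w. \<forall>v \<in> ?C w. (u, v) \<in> E \<longrightarrow> g u = g v \<or> u \<in> T \<and> v \<in> T \<and> c u \<noteq> (c v :: bool)) \<and>
    layered E d (?C w - T)"
  have "\<exists>T c g. ?P w T c g" if "w \<in> k ` W" for w
  proof -
    have "layered E (Suc d) (?C w)" using that Suc.prems(1) by auto
    then show ?thesis unfolding layered.simps by (elim exE conjE) (intro exI conjI, assumption+)
  qed
  then have "\<exists>T. \<forall>w \<in> k ` W. \<exists>c. \<exists>g. ?P w (T w) c g" by (intro bchoice ballI)
  then obtain T where "\<forall>w \<in> k ` W. \<exists>c. \<exists>g. ?P w (T w) c g" by (elim exE)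
  then have "\<exists>c. \<forall>w \<in> k ` W. \<exists>g. ?P w (T w) (c w) g" by (intro bchoice)
  then obtain c where "\<forall>w \<in> k ` W. \<exists>g. ?P w (T w) (c w) g" by (elim exE)
  then have "\<exists>g. \<forall>w \<in> k ` W. ?P w (T w) (c w) (g w)" by (intro bchoice)
  then obtain g where "\<forall>w \<in> k ` W. ?P w (T w) (c w) (g w)" by (elim exE)
  then have P: "?P w (T w) (c w) (g w)" if "w \<in> k ` W" for w using that by (rule bspec)
  let ?T = "{x \<in> W. x \<in> T (k x)}"
  have "layered E d (W - ?T)"
  proof (rule Suc.IH)
    fix w assume w: "w \<in> W - ?T"
    then have "layered E d (?C (k w) - T (k w))" using P by blast
    moreover have "?C (k w) - T (k w) = {x \<in> W - ?T. k x = k w}" by auto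
    ultimately show "layered E d {x \<in> W - ?T. k x = k w}" by simp
  next
    fix u v assume "u \<in> W - ?T" "v \<in> W - ?T" "(u, v) \<in> E"
    then show "k u = k v" using Suc.prems(2) by auto
  qed
  moreover have "g (k u) u = g (k v) v \<or> u \<in> ?T \<and> v \<in> ?T \<and> c (k u) u \<noteq> c (k v) v"
    if "u \<in> W" "v \<in> W" "(u, v) \<in> E" for u v
  proof -
    have "k u = k v" using that Suc.prems(2) by auto
    then show ?thesis using P[of "k u"] that by auto
  qed
  moreover have "\<forall>t \<in> ?T. g (k t) t = t" using P by auto
  ultimately show ?case
    unfolding layered.simps
    by (intro exI[of _ ?T] exI[of _ "\<lambda>x. c (k x) x"] exI[of _ "\<lambda>x. g (k x) x"] conjI)
       auto
qed

section \<open>Maximum independent sets as a lattice\<close>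

text \<open>Witnesses are accumulated one requirement at a time; combining two of them loses no
  requirement that either one meets. In the applications the combination is a meet or a
  join.\<close>

lemma common_witness:
  assumes "finite L" "A \<noteq> {}" "\<And>l. l \<in> L \<Longrightarrow> \<exists>S \<in> A. Q l S"
    and "\<And>S S'. S \<in> A \<Longrightarrow> S' \<in> A \<Longrightarrow> \<exists>R \<in> A. \<forall>l. Q l S \<or> Q l S' \<longrightarrow> Q l R"
  shows "\<exists>S \<in> A. \<forall>l \<in> L. Q l S"
  using assms(1,3)
proof (induction L)
  case empty
  then show ?case using assms(2) by auto
next
  case (insert l L)
  then obtain S where "S \<in> A" "\<forall>l \<in> L. Q l S" by auto
  moreover obtain S' where "S' \<in> A" "Q l S'" using insert.prems[of l] by auto
  ultimately show ?case using assms(4)[of S S'] by (metis insert_iff)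
qed

lemma lattice_helly:
  fixes x :: "'j \<Rightarrow> 's \<Rightarrow> bool"
  assumes "finite L" "finite U" "A \<noteq> {}"
    and join: "\<And>S S'. S \<in> A \<Longrightarrow> S' \<in> A \<Longrightarrow> \<exists>R \<in> A. \<forall>j. x j R \<longleftrightarrow> x j S \<or> x j S'"
    and meet: "\<And>S S'. S \<in> A \<Longrightarrow> S' \<in> A \<Longrightarrow> \<exists>R \<in> A. \<forall>j. x j R \<longleftrightarrow> x j S \<and> x j S'"
    and L: "\<And>l. l \<in> L \<Longrightarrow> \<exists>S \<in> A. \<not> x l S"
    and LU: "\<And>l u. l \<in> L \<Longrightarrow> u \<in> U \<Longrightarrow> \<exists>S \<in> A. \<not> x l S \<and> x u S"
    and U: "\<And>u. u \<in> U \<Longrightarrow> \<exists>S \<in> A. x u S"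
  shows "\<exists>S \<in> A. (\<forall>l \<in> L. \<not> x l S) \<and> (\<forall>u \<in> U. x u S)"
proof -
  let ?A = "{S \<in> A. \<forall>l \<in> L. \<not> x l S}"
  have "\<exists>S \<in> A. \<forall>l \<in> L. \<not> x l S"
    by (rule common_witness) (use assms in \<open>auto, metis\<close>)
  then have ne: "?A \<noteq> {}" by auto
  have one: "\<exists>S \<in> ?A. x u S" if u: "u \<in> U" for u
  proof -
    \<comment> \<open>Meets of sets that are true at \<open>u\<close> stay true at \<open>u\<close>
      and inherit every false coordinate.\<close>
    have "\<exists>S \<in> {S \<in> A. x u S}. \<forall>l \<in> L. \<not> x l S"
    proof (rule common_witness)
      fix S S' assume "S \<in> {S \<in> A. x u S}" "S' \<in> {S \<in> A. x u S}"
      then show "\<exists>R \<in> {S \<in> A. x u S}. \<forall>l. \<not> x l S \<or> \<not> x l S' \<longrightarrow> \<not> x l R"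
        using meet[of S S'] by auto
    qed (use assms(1) U[OF u] LU u in auto)
    then show ?thesis by auto
  qed
  \<comment> \<open>Joins keep the coordinates in \<open>L\<close> false, so the combination stays
    inside \<open>?A\<close>.\<close>
  have "\<exists>S \<in> ?A. \<forall>u \<in> U. x u S"
  proof (rule common_witness)
    fix S S' assume "S \<in> ?A" "S' \<in> ?A"
    then show "\<exists>R \<in> ?A. \<forall>l. x l S \<or> x l S' \<longrightarrow> x l R"
      using join[of S S'] by auto
  qed (use assms(2) ne one in auto)
  then show ?thesis by auto
qed

section \<open>Recombining maximum independent sets bag by bag\<close>

locale bags =
  fixes E :: "('a \<times> 'a) set" and V T :: "'a set" and c :: "'a \<Rightarrow> bool" and g :: "'a \<Rightarrow> 'a"
  assumes sym_E: "sym E" and finite_V: "finite V" and T_V: "T \<subseteq> V"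
    and g_T: "t \<in> T \<Longrightarrow> g t = t"
    and edge: "\<lbrakk>u \<in> V; v \<in> V; (u, v) \<in> E\<rbrakk> \<Longrightarrow> g u = g v \<or> u \<in> T \<and> v \<in> T \<and> c u \<noteq> c v"
begin

text \<open>A bag whose name lies outside \<open>T\<close> has no top-level vertex and constant
  state \<open>False\<close>.\<close>

definition state :: "'a \<Rightarrow> 'a set \<Rightarrow> bool" where
  "state j S \<longleftrightarrow> j \<in> S \<inter> T"

text \<open>
  The negation on one colour class turns the non-adjacency constraints on \<open>T\<close> into implications,
  which are preserved by pointwise joins and meets.
\<close>

definition up :: "'a \<Rightarrow> 'a set \<Rightarrow> bool" where
  "up j S \<longleftrightarrow> state j S \<noteq> c j"

definition merge :: "('a \<Rightarrow> bool) \<Rightarrow> 'a set \<Rightarrow> 'a set \<Rightarrow> 'a set" where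
  "merge p S R = {x \<in> S. p (g x)} \<union> {x \<in> R. \<not> p (g x)}"

lemma state_merge: "state j (merge p S R) = (if p j then state j S else state j R)"
  using g_T by (auto simp: state_def merge_def)

text \<open>Inside a bag the merge agrees with \<open>S\<close> or with \<open>R\<close>. An edge
  between bags joins differently coloured vertices of \<open>T\<close>, so by symmetry only pairs
  with \<open>c s\<close> and \<open>\<not> c t\<close> need checking.\<close>

lemma indep_merge:
  assumes "S \<subseteq> V" "R \<subseteq> V" "indep E S" "indep E R"
    and T: "\<And>s t. \<lbrakk>state s (merge p S R); state t (merge p S R); c s; \<not> c t\<rbrakk> \<Longrightarrow> (s, t) \<notin> E"
  shows "indep E (merge p S R)"
  unfolding indep_def
proof (intro ballI notI)
  fix u v assume u: "u \<in> merge p S R" and v: "v \<in> merge p S R" and uv: "(u, v) \<in> E"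
  have V: "u \<in> V" "v \<in> V" using u v assms(1,2) by (auto simp: merge_def)
  from edge[OF V uv] show False
  proof
    assume "g u = g v"
    then show False using u v uv assms(3,4) by (auto simp: merge_def indep_def)
  next
    assume *: "u \<in> T \<and> v \<in> T \<and> c u \<noteq> c v"
    then have "state u (merge p S R)" "state v (merge p S R)" using u v by (auto simp: state_def)
    with T[of u v] T[of v u] * uv sym_E show False by (auto dest: symD)
  qed
qed

lemma max_indep_finite: "max_indep E V S \<Longrightarrow> finite S"
  using finite_V by (auto simp: max_indep_def intro: finite_subset)

lemma card_merge:
  assumes "finite S" "finite R"
  shows "card (merge p S R) + card (merge p R S) = card S + card R"
proof -
  have *: "card (merge p S R) = card {x \<in> S. p (g x)} + card {x \<in> R. \<not> p (g x)}"
    if "finite S" "finite R" for S R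
    unfolding merge_def using that by (intro card_Un_disjoint) auto
  have "card S = card {x \<in> S. p (g x)} + card {x \<in> S. \<not> p (g x)}" if "finite S" for S
    using that by (subst card_Un_disjoint[symmetric]) (auto intro: arg_cong[where f = card])
  from *[OF assms] *[OF assms(2,1)] this[OF assms(1)] this[OF assms(2)]
  show ?thesis by linarith
qed

text \<open>Neither merge exceeds the maximum size, while by \<open>card_merge\<close> their sizes
  add up to twice the maximum; so both attain it.\<close>

lemma max_indep_merge:
  assumes S: "max_indep E V S" and R: "max_indep E V R"
    and ind: "indep E (merge p S R)" "indep E (merge p R S)"
  shows "max_indep E V (merge p S R)" "max_indep E V (merge p R S)"
proof -
  have sub: "merge p S R \<subseteq> V" "merge p R S \<subseteq> V"
    using S R by (auto simp: max_indep_def merge_def)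
  have le: "card (merge p S R) \<le> card S" "card (merge p R S) \<le> card S" "card R = card S"
    using S R sub ind by (auto simp: max_indep_def intro: antisym)
  then have "card (merge p S R) = card S" "card (merge p R S) = card S"
    using card_merge[OF max_indep_finite[OF S] max_indep_finite[OF R], of p] by linarith+
  then show "max_indep E V (merge p S R)" "max_indep E V (merge p R S)"
    using sub ind S by (auto simp: max_indep_def)
qed

lemma join_meet:
  assumes S: "max_indep E V S" and R: "max_indep E V R"
  shows "\<exists>Q. max_indep E V Q \<and> (\<forall>j. up j Q \<longleftrightarrow> up j S \<or> up j R)"
    and "\<exists>Q. max_indep E V Q \<and> (\<forall>j. up j Q \<longleftrightarrow> up j S \<and> up j R)"
proof -
  \<comment> \<open>Taking \<open>S\<close> in the bags where it is up and \<open>R\<close>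
    elsewhere gives the join; the opposite choice gives the meet.\<close>
  let ?p = "\<lambda>j. up j S"
  have up: "up j (merge ?p S R) \<longleftrightarrow> up j S \<or> up j R" "up j (merge ?p R S) \<longleftrightarrow> up j S \<and> up j R" for j
    by (auto simp: up_def state_merge)
  have *: "S \<subseteq> V" "R \<subseteq> V" "indep E S" "indep E R" using S R by (auto simp: max_indep_def)
  have conflict: "(s, t) \<notin> E" if "state s Q" "state t Q" "indep E Q" for s t Q
    using that by (auto simp: state_def indep_def)
  have 1: "indep E (merge ?p S R)"
  proof (rule indep_merge[OF *])
    fix s t assume "state s (merge ?p S R)" "state t (merge ?p S R)" "c s" "\<not> c t"
    \<comment> \<open>Being up is negated at \<open>s\<close>, so if the join contains
      \<open>s\<close> then both sets do, and one of them also contains \<open>t\<close>.\<close>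
    then have "(state s S \<and> state s R) \<and> (state t S \<or> state t R)" using up[of s] up[of t]
      by (auto simp: up_def)
    then show "(s, t) \<notin> E" using conflict *(3,4) by blast
  qed
  have 2: "indep E (merge ?p R S)"
  proof (rule indep_merge[OF *(2,1,4,3)])
    fix s t assume "state s (merge ?p R S)" "state t (merge ?p R S)" "c s" "\<not> c t"
    then have "(state s S \<or> state s R) \<and> (state t S \<and> state t R)" using up[of s] up[of t]
      by (auto simp: up_def)
    then show "(s, t) \<notin> E" using conflict *(3,4) by blast
  qed
  show "\<exists>Q. max_indep E V Q \<and> (\<forall>j. up j Q \<longleftrightarrow> up j S \<or> up j R)"
    using max_indep_merge(1)[OF S R 1 2] up(1) by blast
  show "\<exists>Q. max_indep E V Q \<and> (\<forall>j. up j Q \<longleftrightarrow> up j S \<and> up j R)"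
    using max_indep_merge(2)[OF S R 1 2] up(2) by blast
qed

section \<open>Replacing single bags and forbidding their states\<close>

lemma indep_replace:
  assumes "S \<subseteq> V" "P \<subseteq> V" "indep E S" "indep E P" "state j P = state j S"
  shows "indep E (merge (\<lambda>i. i \<noteq> j) S P)"
proof (rule indep_merge[OF assms(1-4)])
  fix s t assume "state s (merge (\<lambda>i. i \<noteq> j) S P)" "state t (merge (\<lambda>i. i \<noteq> j) S P)"
  \<comment> \<open>Equal states at \<open>j\<close> mean that the replacement changes no state, so
    an edge between bags would already lie in \<open>S\<close>.\<close>
  then have "state s S" "state t S"
    using assms(5) by (auto simp: state_merge split: if_splits)
  then show "(s, t) \<notin> E" using assms(3) by (auto simp: state_def indep_def)
qed

lemma max_indep_replace:
  assumes "max_indep E V S" "max_indep E V R" "state j R = state j S"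
  shows "max_indep E V (merge (\<lambda>i. i \<noteq> j) S R)"
  using assms by (intro max_indep_merge indep_replace) (auto simp: max_indep_def)

text \<open>A state that no maximum independent set attains is killed vacuously, so unattainable and
  blocked states are treated alike.\<close>

definition killed :: "'a set \<Rightarrow> 'a \<Rightarrow> bool \<Rightarrow> bool" where
  "killed Y j b \<longleftrightarrow>
     (\<forall>S. max_indep E V S \<longrightarrow> state j S = b \<longrightarrow> (\<exists>x \<in> S \<inter> Y. g x = j))"

text \<open>A bag whose state is not killed can be exchanged for one with the same state that avoids
  \<open>Y\<close>. Doing this for all bags would give a maximum independent set disjoint from
  \<open>Y\<close>.\<close>

lemma not_killed_everywhere:
  assumes "hits E V Y" "max_indep E V S" "\<And>j. j \<in> g ` V \<Longrightarrow> \<not> killed Y j (state j S)"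
  shows False
proof -
  have "\<exists>R. max_indep E V R \<and> (\<forall>j. state j R = state j S) \<and> (\<forall>x \<in> R \<inter> Y. g x \<notin> J)"
    if "finite J" "J \<subseteq> g ` V" for J
    using that
  proof (induction J)
    case empty
    then show ?case using assms(2) by auto
  next
    case (insert j J)
    then obtain R where R: "max_indep E V R" "\<forall>j. state j R = state j S"
      "\<forall>x \<in> R \<inter> Y. g x \<notin> J" by auto
    obtain Q where Q: "max_indep E V Q" "state j Q = state j S" "\<forall>x \<in> Q \<inter> Y. g x \<noteq> j"
      using assms(3)[of j] insert.prems by (auto simp: killed_def)
    have "max_indep E V (merge (\<lambda>i. i \<noteq> j) R Q)"
      using R Q by (intro max_indep_replace) auto
    moreover have "\<forall>i. state i (merge (\<lambda>i. i \<noteq> j) R Q) = state i S"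
      using R Q by (auto simp: state_merge)
    moreover have "\<forall>x \<in> merge (\<lambda>i. i \<noteq> j) R Q \<inter> Y. g x \<notin> insert j J"
      using R Q by (auto simp: merge_def)
    ultimately show ?case by blast
  qed
  from this[of "g ` V"] obtain R where "max_indep E V R" "\<forall>x \<in> R \<inter> Y. g x \<notin> g ` V"
    using finite_V by auto
  moreover from this have "R \<inter> Y \<noteq> {}" "R \<subseteq> V"
    using assms(1) by (simp_all add: hits_def max_indep_def)
  ultimately show False by blast
qed

text \<open>Otherwise any two killed states can be avoided together, and
  \<open>lattice_helly\<close> provides a maximum independent set avoiding all of them, against
  \<open>not_killed_everywhere\<close>.\<close>

lemma two_killed:
  assumes hit: "hits E V Y" and ex: "\<exists>S. max_indep E V S"
  shows "\<exists>i a j b. killed Y i a \<and> killed Y j b \<and>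
    (\<forall>S. max_indep E V S \<longrightarrow> state i S = a \<or> state j S = b)"
proof (rule ccontr)
  assume "\<not> ?thesis"
  then have neg: "\<exists>S \<in> Collect (max_indep E V). state i S \<noteq> a \<and> state j S \<noteq> b"
    if "killed Y i a" "killed Y j b" for i a j b using that by blast
  \<comment> \<open>State \<open>\<not> c j\<close> is the up state, so killing it demands down;
    killing \<open>c j\<close> demands up. The one-coordinate conditions come from
    \<open>neg\<close> applied to the same killed state twice.\<close>
  let ?L = "{j \<in> g ` V. killed Y j (\<not> c j)}" and ?U = "{j \<in> g ` V. killed Y j (c j)}"
  have "\<exists>S \<in> Collect (max_indep E V). (\<forall>l \<in> ?L. \<not> up l S) \<and> (\<forall>u \<in> ?U. up u S)"
  proof (rule lattice_helly)
    show "\<exists>S \<in> Collect (max_indep E V). \<not> up l S" if "l \<in> ?L" for l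
      using neg[of l "\<not> c l" l "\<not> c l"] that by (auto simp: up_def)
    show "\<exists>S \<in> Collect (max_indep E V). up l S" if "l \<in> ?U" for l
      using neg[of l "c l" l "c l"] that by (auto simp: up_def)
    show "\<exists>S \<in> Collect (max_indep E V). \<not> up l S \<and> up u S" if "l \<in> ?L" "u \<in> ?U" for l u
      using neg[of l "\<not> c l" u "c u"] that by (auto simp: up_def)
  qed (use finite_V ex join_meet in auto)
  then obtain S where S: "max_indep E V S" "\<forall>l \<in> ?L. \<not> up l S" "\<forall>u \<in> ?U. up u S" by auto
  show False
  proof (rule not_killed_everywhere[OF hit S(1)])
    fix j assume j: "j \<in> g ` V"
    show "\<not> killed Y j (state j S)"
    proof
      assume k: "killed Y j (state j S)"
      show False
      proof (cases "state j S = c j")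
        case True
        with k j S(3) show False by (auto simp: up_def)
      next
        case False
        then have "state j S = (\<not> c j)" by auto
        with k j S(2) show False by (auto simp: up_def)
      qed
    qed
  qed
qed

text \<open>Once the state of bag \<open>j\<close> is fixed, the rest of the bag is optimised
  independently of the other bags, on a set \<open>M\<close> disjoint from \<open>T\<close>. Unless
  \<open>j\<close> itself does the killing, killing the state means hitting the maximum independent
  sets of \<open>M\<close>, to which \<open>IH\<close> applies.\<close>

lemma killed_small:
  assumes IH: "\<And>M Y. M \<subseteq> V - T \<Longrightarrow> hits E M Y \<Longrightarrow>
      \<exists>Y' \<subseteq> Y. finite Y' \<and> card Y' \<le> k \<and> hits E M Y'"
    and k: "1 \<le> k" and kill: "killed Y j b"
  shows "\<exists>Y' \<subseteq> Y. finite Y' \<and> card Y' \<le> k \<and> killed Y' j b"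
proof (cases "\<exists>S. max_indep E V S \<and> state j S = b")
  case False
  then show ?thesis by (intro exI[of _ "{}"]) (auto simp: killed_def)
next
  case True
  show ?thesis
  proof (cases "b \<and> j \<in> Y")
    case True
    then have "killed {j} j b" using g_T by (auto simp: killed_def state_def)
    with True k show ?thesis by (intro exI[of _ "{j}"]) auto
  next
    case nY: False
    \<comment> \<open>\<open>M\<close> is the part of the bag still free under state
      \<open>b\<close>; \<open>B\<close> is the contribution of the top-level vertex.\<close>
    define M where "M = {x \<in> V - T. g x = j \<and> (b \<longrightarrow> (x, j) \<notin> E)}"
    define B where "B = (if b then {j} else {})"
    have bT: "b \<Longrightarrow> j \<in> T" using True by (auto simp: state_def)
    have finM: "finite M" using finite_V by (auto simp: M_def)
    have piece: "S \<inter> M \<union> B = {x \<in> S. g x = j}" "indep E B"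
      if S: "max_indep E V S" "state j S = b" for S
    proof -
      have M: "x \<in> M" if "x \<in> S" "g x = j" "x \<notin> B" for x
      proof -
        have "x \<notin> T" using that S g_T by (auto simp: state_def B_def split: if_splits)
        moreover have "x \<in> V" using S that by (auto simp: max_indep_def)
        moreover have "b \<longrightarrow> (x, j) \<notin> E"
          using S that by (auto simp: max_indep_def indep_def state_def)
        ultimately show ?thesis using that by (auto simp: M_def)
      qed
      have "x \<in> S \<and> g x = j" if "x \<in> B" for x
        using that S bT g_T by (auto simp: B_def state_def split: if_splits)
      moreover have "g x = j" if "x \<in> M" for x using that by (simp add: M_def)
      ultimately show "S \<inter> M \<union> B = {x \<in> S. g x = j}"
        using M by blast
      show "indep E B" using S by (auto simp: B_def max_indep_def indep_def state_def)
    qed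
    \<comment> \<open>Any independent subset of \<open>M\<close> can be substituted for
      \<open>S \<inter> M\<close>. Maximality of \<open>S\<close> bounds its size, and equality
      yields another maximum independent set.\<close>
    have exch: "card R \<le> card (S \<inter> M) \<and>
        (card R = card (S \<inter> M) \<longrightarrow> (\<exists>Q. max_indep E V Q \<and> state j Q = b \<and> {x \<in> Q. g x = j} = R \<union> B))"
      if S: "max_indep E V S" "state j S = b" and R: "R \<subseteq> M" "indep E R" for S R
    proof -
      let ?Q = "merge (\<lambda>i. i \<noteq> j) S (R \<union> B)"
      have SV: "S \<subseteq> V" "finite S" "indep E S"
        using S max_indep_finite by (auto simp: max_indep_def)
      have RB: "R \<union> B \<subseteq> V" "indep E (R \<union> B)" "state j (R \<union> B) = b"
      proof -
        show "R \<union> B \<subseteq> V" using R bT T_V by (auto simp: M_def B_def split: if_splits)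
        show "state j (R \<union> B) = b" using R bT by (auto simp: M_def B_def state_def split: if_splits)
        show "indep E (R \<union> B)"
          using piece(2)[OF S] R sym_E by (auto simp: indep_def B_def M_def dest: symD split: if_splits)
      qed
      have "indep E ?Q" using SV RB S by (intro indep_replace) auto
      moreover have "?Q \<subseteq> V" using SV RB by (auto simp: merge_def)
      ultimately have le: "card ?Q \<le> card S" using S by (auto simp: max_indep_def)
      have bag: "g x = j" if "x \<in> R \<union> B" for x
        using that R bT g_T by (auto simp: M_def B_def split: if_splits)
      then have Qeq: "?Q = {x \<in> S. g x \<noteq> j} \<union> (R \<union> B)" by (auto simp: merge_def)
      have fin: "finite R" "finite B" using R finM by (auto intro: finite_subset simp: B_def)
      have RBd: "R \<inter> B = {}" "S \<inter> M \<inter> B = {}"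
        using R bT by (auto simp: M_def B_def split: if_splits)
      have "card ?Q = card {x \<in> S. g x \<noteq> j} + card (R \<union> B)"
        unfolding Qeq using fin SV bag by (intro card_Un_disjoint) auto
      then have cQ: "card ?Q = card {x \<in> S. g x \<noteq> j} + card R + card B"
        using fin RBd by (simp add: card_Un_disjoint)
      have "S = {x \<in> S. g x \<noteq> j} \<union> {x \<in> S. g x = j}" by auto
      then have "card S = card {x \<in> S. g x \<noteq> j} + card {x \<in> S. g x = j}"
        using SV card_Un_disjoint[of "{x \<in> S. g x \<noteq> j}" "{x \<in> S. g x = j}"] by auto
      then have cS: "card S = card {x \<in> S. g x \<noteq> j} + card (S \<inter> M) + card B"
        using fin SV RBd piece(1)[OF S] card_Un_disjoint[of "S \<inter> M" B] by auto
      have "max_indep E V ?Q" if "card R = card (S \<inter> M)"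
        using that cQ cS S \<open>indep E ?Q\<close> \<open>?Q \<subseteq> V\<close> by (auto simp: max_indep_def)
      moreover have "state j ?Q = b" using RB by (simp add: state_merge)
      moreover have "{x \<in> ?Q. g x = j} = R \<union> B" using Qeq bag by auto
      ultimately show ?thesis using le cQ cS by auto
    qed
    have max: "max_indep E M (S \<inter> M)" if "max_indep E V S" "state j S = b" for S
      using exch[OF that] that by (auto simp: max_indep_def indep_def)
    have "hits E M Y"
      unfolding hits_def
    proof (intro allI impI)
      fix R assume R: "max_indep E M R"
      from True obtain S where S: "max_indep E V S" "state j S = b" by auto
      from R max[OF S] have "card R = card (S \<inter> M)" by (auto simp: max_indep_def intro: antisym)
      then obtain Q where Q: "max_indep E V Q" "state j Q = b" "{x \<in> Q. g x = j} = R \<union> B"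
        using exch[OF S, of R] R by (auto simp: max_indep_def)
      then obtain x where "x \<in> R \<union> B" "x \<in> Y" using kill by (fastforce simp: killed_def)
      then show "R \<inter> Y \<noteq> {}" using nY by (auto simp: B_def split: if_splits)
    qed
    then obtain Y' where Y': "Y' \<subseteq> Y" "finite Y'" "card Y' \<le> k" "hits E M Y'"
      using IH[of M Y] by (auto simp: M_def)
    have "killed Y' j b"
      unfolding killed_def
    proof (intro allI impI)
      fix S assume "max_indep E V S" "state j S = b"
      from max[OF this] Y'(4) have "S \<inter> M \<inter> Y' \<noteq> {}" by (auto simp: hits_def)
      then show "\<exists>x \<in> S \<inter> Y'. g x = j" by (auto simp: M_def)
    qed
    with Y' show ?thesis by blast
  qed
qed

lemma small_hitting_set:
  assumes IH: "\<And>M Y. M \<subseteq> V - T \<Longrightarrow> hits E M Y \<Longrightarrow>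
      \<exists>Y' \<subseteq> Y. finite Y' \<and> card Y' \<le> k \<and> hits E M Y'"
    and k: "1 \<le> k" and hit: "hits E V Y"
  shows "\<exists>Y' \<subseteq> Y. finite Y' \<and> card Y' \<le> 2 * k \<and> hits E V Y'"
proof (cases "\<exists>S. max_indep E V S")
  case False
  then show ?thesis by (intro exI[of _ "{}"]) (auto simp: hits_def)
next
  case True
  then obtain i a j b where k2: "killed Y i a" "killed Y j b"
    and cover: "\<forall>S. max_indep E V S \<longrightarrow> state i S = a \<or> state j S = b"
    using two_killed[OF hit] by blast
  obtain A where A: "A \<subseteq> Y" "finite A" "card A \<le> k" "killed A i a"
    using killed_small[OF IH k k2(1)] by blast
  obtain B where B: "B \<subseteq> Y" "finite B" "card B \<le> k" "killed B j b"
    using killed_small[OF IH k k2(2)] by blast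
  \<comment> \<open>Every maximum independent set has one of the two killed states and so meets the
    corresponding small set.\<close>
  have "hits E V (A \<union> B)"
    using A(4) B(4) cover by (fastforce simp: hits_def killed_def)
  moreover have "card (A \<union> B) \<le> 2 * k" using card_Un_le[of A B] A B by linarith
  ultimately show ?thesis using A B by (intro exI[of _ "A \<union> B"]) auto
qed

end

theorem layered_hitting_set:
  assumes "sym E" "finite V" "layered E d V" "hits E V Y"
  shows "\<exists>Y' \<subseteq> Y. finite Y' \<and> card Y' \<le> 2 ^ d \<and> hits E V Y'"
  using assms(2-)
proof (induction d arbitrary: V Y)
  case 0
  \<comment> \<open>The empty set is a maximum independent set here and cannot be hit, so the
    hypothesis is contradictory.\<close>
  then have "max_indep E V {}" by (auto simp: max_indep_def indep_def)
  with 0 show ?case by (auto simp: hits_def)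
next
  case (Suc d)
  then obtain T c g where *: "T \<subseteq> V" "\<forall>t \<in> T. g t = t" "layered E d (V - T)"
    "\<forall>u \<in> V. \<forall>v \<in> V. (u, v) \<in> E \<longrightarrow> g u = g v \<or> u \<in> T \<and> v \<in> T \<and> c u \<noteq> (c v :: bool)"
    by auto
  interpret bags E V T c g
    using assms(1) Suc.prems(1) * by unfold_locales auto
  have "\<exists>Y' \<subseteq> Y. finite Y' \<and> card Y' \<le> 2 * 2 ^ d \<and> hits E V Y'"
  proof (rule small_hitting_set)
    fix M Y assume M: "M \<subseteq> V - T" and "hits E M Y"
    moreover have "finite M" using M Suc.prems(1) by (auto intro: finite_subset)
    moreover have "layered E d M" using layered_subset[OF *(3) M] .
    ultimately show "\<exists>Y' \<subseteq> Y. finite Y' \<and> card Y' \<le> 2 ^ d \<and> hits E M Y'"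
      using Suc.IH by blast
  qed (use Suc.prems in auto)
  then show ?case by simp
qed

section \<open>Bridges and contractions\<close>

definition separates :: "('a \<times> 'a) set \<Rightarrow> 'a set \<Rightarrow> 'a set \<Rightarrow> 'a \<Rightarrow> 'a \<Rightarrow> bool" where
  "separates E W A a b \<longleftrightarrow>
     a \<in> A \<and> b \<notin> A \<and> (\<forall>x \<in> W \<inter> A. \<forall>y \<in> W - A. (x, y) \<in> E \<longrightarrow> x = a \<and> y = b)"

text \<open>A bridge, described by a cut with one crossing edge rather than by counting components;
  this form restricts directly to subsets of \<open>W\<close>.\<close>

definition cut_edge :: "('a \<times> 'a) set \<Rightarrow> 'a set \<Rightarrow> 'a \<Rightarrow> 'a \<Rightarrow> bool" where
  "cut_edge E W a b \<longleftrightarrow> a \<in> W \<and> b \<in> W \<and> (a, b) \<in> E \<and> (\<exists>A. separates E W A a b)"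

definition cut_edges :: "('a \<times> 'a) set \<Rightarrow> 'a set \<Rightarrow> 'a set \<Rightarrow> ('a \<times> 'a) set" where
  "cut_edges E W F = {(x, y). x \<in> F \<and> y \<in> F \<and> cut_edge E W x y}"

definition cut_connected :: "('a \<times> 'a) set \<Rightarrow> 'a set \<Rightarrow> 'a set \<Rightarrow> bool" where
  "cut_connected E W F \<longleftrightarrow> F \<subseteq> W \<and> (\<forall>p \<in> F. \<forall>q \<in> F. (p, q) \<in> (cut_edges E W F)\<^sup>*)"

lemma cut_edge_subset:
  assumes "cut_edge E W a b" "W' \<subseteq> W" "a \<in> W'" "b \<in> W'"
  shows "cut_edge E W' a b"
proof -
  obtain A where "separates E W A a b" using assms(1) by (auto simp: cut_edge_def)
  then have "separates E W' A a b" using assms(2) by (auto simp: separates_def)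
  then show ?thesis using assms by (auto simp: cut_edge_def)
qed

lemma cut_connected_subset:
  assumes "cut_connected E W F" "F \<subseteq> W'" "W' \<subseteq> W"
  shows "cut_connected E W' F"
proof -
  have "cut_edges E W F \<subseteq> cut_edges E W' F"
    using assms by (auto simp: cut_edges_def intro: cut_edge_subset)
  then have "(cut_edges E W F)\<^sup>* \<subseteq> (cut_edges E W' F)\<^sup>*" by (rule rtrancl_mono)
  then show ?thesis
    using assms unfolding cut_connected_def by blast
qed

lemma first_entry:
  assumes "(p, w) \<in> R ^^ n" "p \<notin> A" "w \<in> A"
  shows "\<exists>m < n. \<exists>x y. (p, x) \<in> R ^^ m \<and> (x, y) \<in> R \<and> x \<notin> A \<and> y \<in> A"
  using assms
proof (induction n arbitrary: w)
  case (Suc n)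
  then obtain z where z: "(p, z) \<in> R ^^ n" "(z, w) \<in> R" by auto
  show ?case
  proof (cases "z \<in> A")
    case True
    then show ?thesis using Suc.IH[OF z(1)] Suc.prems by (meson less_SucI)
  next
    case False
    then show ?thesis using z Suc.prems by blast
  qed
qed auto

text \<open>Take the cut \<open>A\<close> of the last edge \<open>(w, q)\<close> of a walk from
  \<open>p\<close>. If \<open>p\<close> is outside \<open>A\<close>, the walk enters
  \<open>A\<close> on its way to \<open>w\<close>; only \<open>wq\<close> crosses the cut, so it
  enters from \<open>q\<close>, and a shorter walk already reaches \<open>q\<close>.\<close>

lemma separating_cut_edge:
  assumes "sym E" "(p, q) \<in> (cut_edges E W F)\<^sup>*" "p \<noteq> q"
  shows "\<exists>a \<in> F. \<exists>b \<in> F. \<exists>A. p \<in> A \<and> q \<notin> A \<and> separates E W A a b \<and> cut_edge E W a b"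
proof -
  let ?R = "cut_edges E W F"
  obtain n where "(p, q) \<in> ?R ^^ n" using assms(2) rtrancl_power by blast
  then show ?thesis using assms(3)
  proof (induction n arbitrary: q rule: less_induct)
    case (less n)
    then obtain m where n: "n = Suc m" by (cases n) auto
    then obtain w where w: "(p, w) \<in> ?R ^^ m" "(w, q) \<in> ?R" using less.prems by auto
    then obtain A where A: "separates E W A w q" and wq: "w \<in> F" "q \<in> F" "cut_edge E W w q"
      by (auto simp: cut_edges_def cut_edge_def)
    show ?case
    proof (cases "p \<in> A")
      case True
      then show ?thesis using A wq unfolding separates_def by blast
    next
      case False
      moreover have "w \<in> A" using A by (simp add: separates_def)
      ultimately obtain l x y where l: "l < m" "(p, x) \<in> ?R ^^ l" "(x, y) \<in> ?R" "x \<notin> A" "y \<in> A"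
        using first_entry[OF w(1)] by blast
      then have "x \<in> W" "y \<in> W" "(y, x) \<in> E"
        using assms(1) by (auto simp: cut_edges_def cut_edge_def dest: symD)
      then have "x = q" using A l by (auto simp: separates_def)
      then show ?thesis using less.IH[of l x] l n less.prems by auto
    qed
  qed
qed

text \<open>Otherwise a cut edge with both ends in \<open>F\<close> separates \<open>t\<close> from
  \<open>t'\<close>. Every edge of the walk has an end outside \<open>F\<close>, so the walk cannot
  change sides.\<close>

lemma unique_attachment:
  assumes E: "sym E" and F: "cut_connected E W F" "t \<in> F" "t' \<in> F"
    and walk: "(t, y) \<in> E" "y \<in> W - F" "(y, y') \<in> (Restr E (W - F))\<^sup>*" "(y', t') \<in> E"
  shows "t = t'"
proof (rule ccontr)
  assume "t \<noteq> t'"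
  then obtain a b A where ab: "a \<in> F" "b \<in> F" "t \<in> A" "t' \<notin> A" "separates E W A a b"
    using separating_cut_edge[OF E, of t t' W F] F unfolding cut_connected_def by blast
  have W: "t \<in> W" "t' \<in> W" using F by (auto simp: cut_connected_def)
  from walk(3) have "y' \<in> A \<and> y' \<in> W - F"
  proof induction
    case base
    then show ?case using ab W walk(1,2) by (auto simp: separates_def)
  next
    case (step x z)
    then show ?case using ab by (auto simp: separates_def)
  qed
  then show False using ab W walk(4) by (auto simp: separates_def)
qed

lemma cut_edges_two_colouring:
  assumes "finite F" "sym E" "\<And>a b. (a, b) \<in> F \<Longrightarrow> cut_edge E W a b"
  shows "\<exists>c :: 'a \<Rightarrow> bool. \<forall>(a, b) \<in> F. c a \<noteq> c b"
  using assms(1,3)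
proof (induction F)
  case (insert e F)
  obtain a b where e: "e = (a, b)" by (cases e)
  obtain c :: "'a \<Rightarrow> bool" where c: "\<forall>(a, b) \<in> F. c a \<noteq> c b" using insert by auto
  obtain A where A: "separates E W A a b" using insert.prems[of a b] e by (auto simp: cut_edge_def)
  show ?case
  proof (cases "c a = c b")
    case False
    then show ?thesis using c e by auto
  next
    case True
    \<comment> \<open>Flipping one side of the cut repairs the new edge. No old edge crosses the
      cut: only \<open>ab\<close> could, and its ends have equal colours under
      \<open>c\<close>.\<close>
    let ?c = "\<lambda>x. c x \<noteq> (x \<in> A)"
    have "?c x \<noteq> ?c y" if xy: "(x, y) \<in> F" for x y
    proof -
      have "cut_edge E W x y" using insert.prems xy by auto
      then have "x \<in> W" "y \<in> W" "(x, y) \<in> E" "(y, x) \<in> E"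
        using assms(2) by (auto simp: cut_edge_def dest: symD)
      moreover have "c x \<noteq> c y" using c xy by auto
      ultimately have "x \<in> A \<longleftrightarrow> y \<in> A" using A True unfolding separates_def by blast
      then show ?thesis using \<open>c x \<noteq> c y\<close> by simp
    qed
    moreover have "?c a \<noteq> ?c b" using True A by (auto simp: separates_def)
    ultimately show ?thesis using e by (intro exI[of _ ?c]) auto
  qed
qed auto

lemma layered_cut_connected:
  assumes E: "sym E" "irrefl E" and W: "finite W" and T: "cut_connected E W T"
    and rest: "layered E d (W - T)"
  shows "layered E (Suc d) W"
proof -
  have TW: "T \<subseteq> W" using T by (simp add: cut_connected_def)
  let ?F = "Restr E T"
  \<comment> \<open>The cut edge separating \<open>a\<close> from \<open>b\<close> must be
    \<open>ab\<close> itself, which crosses the same cut.\<close>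
  have "cut_edge E W a b" if ab: "(a, b) \<in> ?F" for a b
  proof -
    have "a \<noteq> b" using E(2) ab by (auto simp: irrefl_def)
    then obtain a' b' A where A: "a \<in> A" "b \<notin> A" "separates E W A a' b'" "cut_edge E W a' b'"
      using separating_cut_edge[OF E(1), of a b W T] T ab unfolding cut_connected_def by blast
    then have "a' = a \<and> b' = b" using ab TW by (auto simp: separates_def)
    with A show ?thesis by simp
  qed
  moreover have "finite ?F" using finite_subset[OF TW W] by simp
  ultimately obtain c :: "'a \<Rightarrow> bool" where c: "\<forall>(a, b) \<in> ?F. c a \<noteq> c b"
    using cut_edges_two_colouring[OF _ E(1)] by metis
  let ?R = "Restr E (W - T)"
  \<comment> \<open>These are the top-level vertices adjacent to the component of \<open>x\<close>
    in \<open>W - T\<close>; there is at most one. All vertices of a component share the same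
    \<open>att\<close>, so even an unattached component gets one common default name.\<close>
  define att where "att x t \<longleftrightarrow> t \<in> T \<and> (\<exists>y. (x, y) \<in> ?R\<^sup>* \<and> (y, t) \<in> E)" for x t
  define g where "g x = (if x \<in> T then x else SOME t. att x t)" for x
  have R: "sym ?R" using E(1) by (auto simp: sym_def)
  have 1: "g u = g v" if "u \<in> W - T" "v \<in> W - T" "(u, v) \<in> E" for u v
  proof -
    have "(u, v) \<in> ?R" "(v, u) \<in> ?R" using that symD[OF R] by auto
    then have "att u = att v"
      unfolding att_def fun_eq_iff by (meson converse_rtrancl_into_rtrancl)
    then show ?thesis using that by (simp add: g_def)
  qed
  have 2: "g v = u" if "u \<in> T" "v \<in> W - T" "(u, v) \<in> E" for u v
  proof -
    have "att v u" using that E(1) by (auto simp: att_def dest: symD)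
    moreover have "t = u" if "att v t" for t
    proof -
      from that obtain y where "t \<in> T" "(v, y) \<in> ?R\<^sup>*" "(y, t) \<in> E" by (auto simp: att_def)
      with unique_attachment[OF E(1) T, of u t v y] \<open>u \<in> T\<close> \<open>v \<in> W - T\<close> \<open>(u, v) \<in> E\<close>
      show ?thesis by simp
    qed
    ultimately have "(SOME t. att v t) = u" by (rule some_equality)
    then show ?thesis using that by (simp add: g_def)
  qed
  have gT: "g t = t" if "t \<in> T" for t using that by (simp add: g_def)
  have "g u = g v \<or> u \<in> T \<and> v \<in> T \<and> c u \<noteq> c v"
    if uv: "u \<in> W" "v \<in> W" "(u, v) \<in> E" for u v
  proof (cases "u \<in> T"; cases "v \<in> T")
    assume "u \<notin> T" "v \<in> T"
    then show ?thesis using 2[of v u] gT[of v] uv symD[OF E(1)] by auto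
  qed (use 1[of u v] 2[of u v] gT[of u] c uv in auto)
  then show ?thesis
    using TW gT rest unfolding layered.simps
    by (intro exI[of _ T] exI[of _ c] exI[of _ g] conjI) auto
qed

section \<open>Iterated bridge contractions over the original graph\<close>

text \<open>
  The induction along \<^const>\<open>bd\<close> works with iterated contractions. To avoid transferring facts between
  them, all of them are regarded as contractions of subsets of the original graph.
\<close>

definition contraction ::
  "('a \<times> 'a) set \<Rightarrow> 'a set \<Rightarrow> ('a \<Rightarrow> 'a) \<Rightarrow> 'a pair_pre_digraph \<Rightarrow> bool" where
  "contraction E W \<phi> H \<longleftrightarrow> pverts H = \<phi> ` W \<and>
     parcs H = {(\<phi> u, \<phi> v) | u v. u \<in> W \<and> v \<in> W \<and> (u, v) \<in> E \<and> \<phi> u \<noteq> \<phi> v} \<and>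
     (\<forall>w \<in> W. cut_connected E W {x \<in> W. \<phi> x = \<phi> w})"

lemma contraction_arc:
  "contraction E W \<phi> H \<Longrightarrow> u \<in> W \<Longrightarrow> v \<in> W \<Longrightarrow> (u, v) \<in> E \<Longrightarrow> \<phi> u \<noteq> \<phi> v \<Longrightarrow>
    (\<phi> u, \<phi> v) \<in> parcs H"
  unfolding contraction_def by blast

lemma contraction_induce:
  assumes H: "contraction E W \<phi> H" and S: "S \<subseteq> pverts H"
  shows "contraction E {w \<in> W. \<phi> w \<in> S} \<phi> (pair_induce H S)"
proof -
  have "cut_connected E {w \<in> W. \<phi> w \<in> S} {x \<in> {w \<in> W. \<phi> w \<in> S}. \<phi> x = \<phi> w}"
    if w: "w \<in> W" "\<phi> w \<in> S" for w
  proof -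
    have "{x \<in> {w \<in> W. \<phi> w \<in> S}. \<phi> x = \<phi> w} = {x \<in> W. \<phi> x = \<phi> w}" using w by auto
    moreover have "cut_connected E W {x \<in> W. \<phi> x = \<phi> w}" using H w by (simp add: contraction_def)
    ultimately show ?thesis using w by (auto intro: cut_connected_subset)
  qed
  moreover have "S = \<phi> ` {w \<in> W. \<phi> w \<in> S}" using H S by (auto simp: contraction_def)
  moreover have "parcs (pair_induce H S) = {(\<phi> u, \<phi> v) | u v. u \<in> {w \<in> W. \<phi> w \<in> S} \<and>
      v \<in> {w \<in> W. \<phi> w \<in> S} \<and> (u, v) \<in> E \<and> \<phi> u \<noteq> \<phi> v}"
    using H by (auto simp: contraction_def pair_induce_def)
  ultimately show ?thesis by (simp add: contraction_def pair_induce_def)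
qed

text \<open>
  No second edge can join the fibres of the two ends: together with cut edges inside the fibres it
  would close a cycle.
\<close>

lemma cut_edge_lift:
  assumes E: "sym E" and H: "contraction E W \<phi> H"
    and cut: "cut_edge (parcs H) (pverts H) (\<phi> u) (\<phi> v)"
    and uv: "u \<in> W" "v \<in> W" "(u, v) \<in> E"
  shows "cut_edge E W u v"
proof -
  obtain B where B: "separates (parcs H) (pverts H) B (\<phi> u) (\<phi> v)"
    using cut by (auto simp: cut_edge_def)
  then have ne: "\<phi> u \<noteq> \<phi> v" by (auto simp: separates_def)
  have path: "(p, q) \<in> (Restr E (W - {x \<in> W. \<phi> x = \<phi> w}))\<^sup>*"
    if "p \<in> W" "q \<in> W" "\<phi> p = \<phi> q" "\<phi> p \<noteq> \<phi> w" for p q w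
  proof -
    have "(p, q) \<in> (cut_edges E W {x \<in> W. \<phi> x = \<phi> p})\<^sup>*"
      using H that by (auto simp: contraction_def cut_connected_def)
    moreover have "cut_edges E W {x \<in> W. \<phi> x = \<phi> p} \<subseteq> Restr E (W - {x \<in> W. \<phi> x = \<phi> w})"
      using that by (auto simp: cut_edges_def cut_edge_def)
    ultimately show ?thesis using rtrancl_mono by blast
  qed
  have fibre: "cut_connected E W {x \<in> W. \<phi> x = \<phi> w}" if "w \<in> W" for w
    using H that by (simp add: contraction_def)
  have "separates E W {w. \<phi> w \<in> B} u v"
    unfolding separates_def
  proof (intro conjI ballI impI)
    show "u \<in> {w. \<phi> w \<in> B}" "v \<notin> {w. \<phi> w \<in> B}" using B by (auto simp: separates_def)
    fix u' v' assume u': "u' \<in> W \<inter> {w. \<phi> w \<in> B}" and v': "v' \<in> W - {w. \<phi> w \<in> B}"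
      and e: "(u', v') \<in> E"
    have "\<phi> u' \<noteq> \<phi> v'" using u' v' by auto
    with u' v' e have "(\<phi> u', \<phi> v') \<in> parcs H"
      using contraction_arc[OF H] by auto
    moreover have "\<phi> u' \<in> pverts H" "\<phi> v' \<in> pverts H"
      using H u' v' by (auto simp: contraction_def)
    ultimately have \<phi>: "\<phi> u' = \<phi> u" "\<phi> v' = \<phi> v" using B u' v' by (auto simp: separates_def)
    have sym: "(v, u) \<in> E" "(v', u') \<in> E" using E uv e by (auto dest: symD)
    have "u = u'"
    proof (rule unique_attachment[OF E fibre[OF uv(1)]])
      show "(v, v') \<in> (Restr E (W - {x \<in> W. \<phi> x = \<phi> u}))\<^sup>*"
        using \<phi> ne uv v' by (intro path) auto
      show "(u, v) \<in> E" "(v', u') \<in> E" by fact+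
    qed (use \<phi> ne uv u' in auto)
    moreover have "v = v'"
    proof (rule unique_attachment[OF E fibre[OF uv(2)]])
      show "(u, u') \<in> (Restr E (W - {x \<in> W. \<phi> x = \<phi> v}))\<^sup>*"
        using \<phi> ne uv u' by (intro path) auto
      show "(v, u) \<in> E" "(u', v') \<in> E" by fact+
    qed (use \<phi> ne uv v' in auto)
    ultimately show "u' = u" "v' = v" by simp_all
  qed
  then show ?thesis using uv by (auto simp: cut_edge_def)
qed

text \<open>The witnessing side is what \<open>x\<close> still reaches after deletion of the edge.
  If it contained \<open>y\<close>, the deletion would leave the components unchanged.\<close>

lemma bridge_imp_cut_edge:
  assumes "pair_graph H" and xy: "bridge H x y"
  shows "cut_edge (parcs H) (pverts H) x y"
proof -
  interpret pair_graph H by fact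
  let ?D = "pair_del_edge H x y"
  have D: "pverts ?D = pverts H" "parcs ?D = parcs H - {(x, y), (y, x)}"
    by (simp_all add: pair_del_edge_def)
  have e: "(x, y) \<in> parcs H" "x \<in> pverts H" "y \<in> pverts H"
    using xy by (auto simp: bridge_def dest: in_arcsD1 in_arcsD2)
  interpret D: pair_graph ?D
    using pair_finite_verts pair_finite_arcs
    by unfold_locales
      (auto simp: D symmetric_def sym_def dest: in_arcsD1 in_arcsD2 arcs_symmetric no_loops')
  let ?A = "{z. x \<rightarrow>\<^sup>*\<^bsub>with_proj ?D\<^esub> z}"
  have "y \<notin> ?A"
  proof
    assume "y \<in> ?A"
    then have xy': "x \<rightarrow>\<^sup>*\<^bsub>with_proj ?D\<^esub> y" "y \<rightarrow>\<^sup>*\<^bsub>with_proj ?D\<^esub> x"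
      by (auto intro: D.symmetric_reachable')
    have "p \<rightarrow>\<^sup>*\<^bsub>with_proj ?D\<^esub> q" if "p \<rightarrow>\<^sup>*\<^bsub>with_proj H\<^esub> q" for p q
      using that
    proof (induction rule: reachable_induct)
      case base
      then show ?case by (simp add: D)
    next
      case (step u v)
      have "u \<rightarrow>\<^sup>*\<^bsub>with_proj ?D\<^esub> v"
      proof (cases "(u, v) \<in> {(x, y), (y, x)}")
        case True
        then show ?thesis using xy' by auto
      next
        case False
        with step(2) have "(u, v) \<in> parcs ?D" by (auto simp: D)
        then show ?thesis by (rule D.reachable_adjI)
      qed
      with step show ?case by (blast intro: D.reachable_trans)
    qed
    moreover have "p \<rightarrow>\<^sup>*\<^bsub>with_proj H\<^esub> q" if "p \<rightarrow>\<^sup>*\<^bsub>with_proj ?D\<^esub> q" for p q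
      using that
    proof (induction rule: D.reachable_induct)
      case base
      then show ?case by (simp add: D)
    next
      case (step u v)
      then have "u \<rightarrow>\<^sup>*\<^bsub>with_proj H\<^esub> v" by (auto simp: D intro!: reachable_adjI)
      with step show ?case by (blast intro: reachable_trans)
    qed
    ultimately have "components H = components ?D"
      unfolding pre_digraph.sccs_verts_def by blast
    then show False using xy by (simp add: bridge_def)
  qed
  moreover have "x \<in> ?A" using e by (simp add: D)
  moreover have "p = x \<and> q = y" if "p \<in> ?A" "q \<notin> ?A" "(p, q) \<in> parcs H" for p q
  proof (rule ccontr)
    assume "\<not> (p = x \<and> q = y)"
    moreover have "(p, q) \<noteq> (y, x)" using that \<open>y \<notin> ?A\<close> by auto
    ultimately have "(p, q) \<in> parcs ?D" using that by (auto simp: D)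
    then have "p \<rightarrow>\<^sup>*\<^bsub>with_proj ?D\<^esub> q" by (auto intro!: D.reachable_adjI)
    then show False using that by (auto intro: D.reachable_trans)
  qed
  ultimately have "separates (parcs H) (pverts H) ?A x y" by (auto simp: separates_def)
  then show ?thesis using e by (auto simp: cut_edge_def)
qed

text \<open>Bridges of \<open>H\<close> lift to cut edges over \<open>W\<close>, and the old fibres
  are already joined by cut edges; so the preimage of a whole bridge class is cut-connected.\<close>

lemma contraction_contract_bridges:
  assumes E: "sym E" and HG: "pair_graph H" and H: "contraction E W \<phi> H"
  shows "contraction E W (bridge_rep H \<circ> \<phi>) (contract_bridges H)"
proof -
  interpret pair_graph H by fact
  interpret B: pair_graph "bridge_graph H" using HG by (rule pair_graph_bridge_graph)
  let ?\<psi> = "bridge_rep H \<circ> \<phi>"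
  have V: "pverts H = \<phi> ` W" using H by (simp add: contraction_def)
  have fib: "cut_connected E W {x \<in> W. ?\<psi> x = ?\<psi> w}" if w: "w \<in> W" for w
    unfolding cut_connected_def
  proof (intro conjI ballI)
    fix p q assume p: "p \<in> {x \<in> W. ?\<psi> x = ?\<psi> w}" and q: "q \<in> {x \<in> W. ?\<psi> x = ?\<psi> w}"
    let ?R = "cut_edges E W {x \<in> W. ?\<psi> x = ?\<psi> w}"
    have fibre: "(r, s) \<in> ?R\<^sup>*" if "r \<in> W" "s \<in> W" "\<phi> r = \<phi> s" "?\<psi> r = ?\<psi> w" for r s
    proof -
      have "(r, s) \<in> (cut_edges E W {x \<in> W. \<phi> x = \<phi> r})\<^sup>*"
        using H that by (auto simp: contraction_def cut_connected_def)
      moreover have "cut_edges E W {x \<in> W. \<phi> x = \<phi> r} \<subseteq> ?R"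
        using that by (auto simp: cut_edges_def)
      ultimately show ?thesis using rtrancl_mono by blast
    qed
    \<comment> \<open>The claim covers the whole fibre over \<open>z\<close> because the next lifted
      bridge may start at any of its vertices.\<close>
    have "\<forall>s \<in> W. \<phi> s = z \<longrightarrow> (p, s) \<in> ?R\<^sup>*"
      if "\<phi> p \<rightarrow>\<^sup>*\<^bsub>with_proj (bridge_graph H)\<^esub> z" for z
      using that
    proof (induction rule: B.reachable_induct)
      case base
      then show ?case using fibre[of p] p by auto
    next
      case (step y z)
      then have yz: "bridge H y z" by (simp add: bridge_graph_def)
      then obtain u v where uv: "u \<in> W" "v \<in> W" "(u, v) \<in> E" "y = \<phi> u" "z = \<phi> v"
        using H by (auto simp: contraction_def bridge_def)
      have "bridge_rep H (\<phi> p) = bridge_rep H y"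
        using step(1) p uv by (subst bridge_rep_eq_iff[OF HG]) (auto simp: V)
      moreover have "bridge_rep H y = bridge_rep H z"
      proof -
        have "y \<rightarrow>\<^sup>*\<^bsub>with_proj (bridge_graph H)\<^esub> z" using step(2) by (auto intro: B.reachable_adjI)
        then show ?thesis using uv by (subst bridge_rep_eq_iff[OF HG]) (auto simp: V)
      qed
      ultimately have rep: "?\<psi> u = ?\<psi> w" "?\<psi> v = ?\<psi> w" using p uv by auto
      have "cut_edge E W u v"
        using cut_edge_lift[OF E H] bridge_imp_cut_edge[OF HG yz] uv by simp
      then have "(u, v) \<in> ?R" using uv rep by (auto simp: cut_edges_def)
      moreover have "(p, u) \<in> ?R\<^sup>*" using step(3) uv by simp
      ultimately have pv: "(p, v) \<in> ?R\<^sup>*" by (rule rtrancl_into_rtrancl[rotated])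
      show ?case
      proof (intro ballI impI)
        fix s assume "s \<in> W" "\<phi> s = z"
        then have "(v, s) \<in> ?R\<^sup>*" using uv rep by (intro fibre) auto
        with pv show "(p, s) \<in> ?R\<^sup>*" by (rule rtrancl_trans)
      qed
    qed
    moreover have "\<phi> p \<rightarrow>\<^sup>*\<^bsub>with_proj (bridge_graph H)\<^esub> \<phi> q"
      using p q bridge_rep_eq_iff[OF HG, of "\<phi> p" "\<phi> q"] by (auto simp: V)
    ultimately show "(p, q) \<in> ?R\<^sup>*" using q by auto
  qed auto
  have "parcs (contract_bridges H) =
      {(?\<psi> u, ?\<psi> v) | u v. u \<in> W \<and> v \<in> W \<and> (u, v) \<in> E \<and> ?\<psi> u \<noteq> ?\<psi> v}"
    using H by (force simp: contraction_def contract_bridges_def)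
  then show ?thesis
    using fib V by (simp add: contraction_def contract_bridges_def image_comp)
qed

lemma contraction_id:
  assumes "pair_graph G"
  shows "contraction (parcs G) (pverts G) id G"
proof -
  interpret pair_graph G by fact
  have "cut_connected (parcs G) (pverts G) {x \<in> pverts G. x = w}" for w
    by (auto simp: cut_connected_def)
  then show ?thesis
    by (auto simp: contraction_def dest: in_arcsD1 in_arcsD2 no_loops')
qed

text \<open>The induction follows the recursion of \<open>bd\<close>: the fibre of an optimal
  deleted vertex becomes the top layer, and components are glued by \<open>layered_classes\<close>
  after padding to equal depth.\<close>

lemma layered_contraction:
  assumes "sym E" "irrefl E" "finite W" "pair_graph H" "contraction E W \<phi> H"
  shows "layered E (bd H) W"
  using assms(3-)
proof (induction "card (pverts H)" arbitrary: H W \<phi> rule: less_induct)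
  case less
  interpret pair_graph H by fact
  have V: "pverts H = \<phi> ` W" using less.prems by (simp add: contraction_def)
  show ?case
  proof (cases "pverts H = {}")
    case True
    then show ?thesis using V by (simp add: bd.simps)
  next
    case ne: False
    show ?thesis
    proof (cases "connected (with_proj H)")
      case True
      let ?K = "contract_bridges H"
      let ?f = "\<lambda>v. bd (pair_del_verts ?K {v})"
      have K: "pair_graph ?K" using less.prems by (intro pair_graph_contract_bridges)
      interpret K: pair_graph ?K by fact
      have "Min (?f ` pverts ?K) \<in> ?f ` pverts ?K"
        using K.pair_finite_verts ne by (intro Min_in) (auto simp: contract_bridges_def)
      then obtain v where v: "v \<in> pverts ?K" "Min (?f ` pverts ?K) = ?f v" by auto
      have bd: "bd H = Suc (?f v)"
        using True ne less.prems v(2) by (subst bd.simps) simp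
      let ?\<psi> = "bridge_rep H \<circ> \<phi>"
      have \<psi>: "contraction E W ?\<psi> ?K"
        by (rule contraction_contract_bridges[OF assms(1) less.prems(2,3)])
      let ?W = "{w \<in> W. ?\<psi> w \<in> pverts ?K - {v}}" and ?T = "{w \<in> W. ?\<psi> w = v}"
      have "layered E (?f v) ?W"
      proof (rule less.hyps)
        show "card (pverts (pair_del_verts ?K {v})) < card (pverts H)"
          by (rule card_contract_bridges_del_vert[OF less.prems(2) v(1)])
        show "pair_graph (pair_del_verts ?K {v})"
          unfolding pair_del_verts_def using K by (intro pair_graph_pair_induce) auto
        show "contraction E ?W ?\<psi> (pair_del_verts ?K {v})"
          unfolding pair_del_verts_def using \<psi> by (rule contraction_induce) auto
      qed (use less.prems in auto)
      moreover have "?W = W - ?T" using \<psi> by (auto simp: contraction_def)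
      moreover have "cut_connected E W ?T"
      proof -
        obtain w where "w \<in> W" "?\<psi> w = v" using v \<psi> by (auto simp: contraction_def)
        then show ?thesis using \<psi> by (auto simp: contraction_def)
      qed
      ultimately show ?thesis
        unfolding bd using assms(1,2) less.prems by (intro layered_cut_connected) auto
    next
      case False
      let ?k = "\<lambda>w. scc_of (\<phi> w)"
      have "layered E (bd H) {x \<in> W. ?k x = ?k w}" if w: "w \<in> W" for w
      proof -
        let ?S = "?k w"
        have S: "?S \<in> components H" using w V by (intro scc_of_in_sccs_verts) auto
        then have sub: "?S \<subset> pverts H" using component_psubset[OF less.prems(2) False] by blast
        have "layered E (bd (pair_induce H ?S)) {x \<in> W. \<phi> x \<in> ?S}"
        proof (rule less.hyps)
          show "card (pverts (pair_induce H ?S)) < card (pverts H)"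
            using sub pair_finite_verts by (simp add: pair_induce_def psubset_card_mono)
          show "pair_graph (pair_induce H ?S)"
            using less.prems sub by (intro pair_graph_pair_induce) auto
          show "contraction E {x \<in> W. \<phi> x \<in> ?S} \<phi> (pair_induce H ?S)"
            using less.prems sub by (intro contraction_induce) auto
        qed (use less.prems in auto)
        moreover have "bd (pair_induce H ?S) \<le> bd H"
        proof -
          have "bd H = Max ((\<lambda>S. bd (pair_induce H S)) ` components H)"
            using False ne less.prems by (subst bd.simps) simp
          then show ?thesis using S finite_sccs_verts by simp
        qed
        ultimately have "layered E (bd H) {x \<in> W. \<phi> x \<in> ?S}" by (rule layered_mono)
        moreover have "{x \<in> W. \<phi> x \<in> ?S} = {x \<in> W. ?k x = ?k w}"
          using scc_of_eq in_scc_of_self V by auto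
        ultimately show ?thesis by simp
      qed
      moreover have "?k u = ?k v" if "u \<in> W" "v \<in> W" "(u, v) \<in> E" for u v
      proof (cases "\<phi> u = \<phi> v")
        case False
        then have "(\<phi> u, \<phi> v) \<in> parcs H" using contraction_arc[OF less.prems(3) that] by simp
        then have "\<phi> u \<rightarrow>\<^sup>*\<^bsub>with_proj H\<^esub> \<phi> v" by (auto intro!: reachable_adjI)
        then have "\<phi> u \<in> scc_of (\<phi> v)"
          by (auto simp: scc_of_def intro: symmetric_reachable')
        then show ?thesis by (rule scc_of_eq)
      qed simp
      ultimately show ?thesis by (rule layered_classes)
    qed
  qed
qed

section \<open>Blocking sets\<close>

lemma independence_number_induce:
  assumes "finite W"
  shows "\<exists>S. max_indep (parcs G) W S \<and> card S = independence_number (pair_induce G W)"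
proof -
  let ?I = "{S. independent_set (pair_induce G W) S}"
  have I: "?I = {S. S \<subseteq> W \<and> indep (parcs G) S}"
    by (auto simp: independent_set_def pair_induce_def indep_def)
  have fin: "finite ?I" unfolding I using assms by (auto intro: finite_subset[of _ "Pow W"])
  moreover have "{} \<in> ?I" by (auto simp: I indep_def)
  ultimately have "Max (card ` ?I) \<in> card ` ?I" by (intro Max_in) auto
  then obtain S where S: "S \<in> ?I" "card S = Max (card ` ?I)" by auto
  moreover have "card R \<le> card S" if "R \<in> ?I" for R using S fin that by simp
  ultimately show ?thesis
    using I by (intro exI[of _ S]) (auto simp: max_indep_def independence_number_def)
qed

lemma max_indep_card: "max_indep E V S \<Longrightarrow> max_indep E V R \<Longrightarrow> card S = card R"
  by (simp add: max_indep_def le_antisym)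

text \<open>A maximum independent set missing \<open>Y\<close> survives the deletion. Conversely, if
  the independence number does not drop, a maximum independent set of the remainder is one of
  \<open>G\<close> that misses \<open>Y\<close>.\<close>

lemma blocking_set_iff_hits:
  assumes "pair_graph G" "Y \<subseteq> pverts G"
  shows "blocking_set G Y \<longleftrightarrow> hits (parcs G) (pverts G) Y"
proof -
  interpret pair_graph G by fact
  let ?V = "pverts G" and ?E = "parcs G"
  have "pair_induce G ?V = G"
    by (rule pair_pre_digraph.equality) (auto simp: pair_induce_def dest: in_arcsD1 in_arcsD2)
  then obtain S where S: "max_indep ?E ?V S" "card S = independence_number G"
    using independence_number_induce[OF pair_finite_verts, of G] by auto
  obtain R where R: "max_indep ?E (?V - Y) R" "card R = independence_number (pair_del_verts G Y)"
    using independence_number_induce[of "?V - Y" G] pair_finite_verts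
    by (auto simp: pair_del_verts_def)
  have "card R < card S \<longleftrightarrow> hits ?E ?V Y"
  proof
    assume lt: "card R < card S"
    show "hits ?E ?V Y"
      unfolding hits_def
    proof (intro allI impI notI)
      fix Q assume Q: "max_indep ?E ?V Q" "Q \<inter> Y = {}"
      then have "Q \<subseteq> ?V - Y" "indep ?E Q" unfolding max_indep_def by blast+
      then have "card Q \<le> card R" using R(1) by (simp add: max_indep_def)
      then show False using lt max_indep_card[OF S(1) Q(1)] by simp
    qed
  next
    assume hit: "hits ?E ?V Y"
    show "card R < card S"
    proof (rule ccontr)
      assume "\<not> card R < card S"
      then have "card Q \<le> card R" if "Q \<subseteq> ?V" "indep ?E Q" for Q
        using S(1) that le_trans[of "card Q" "card S" "card R"] by (simp add: max_indep_def)
      moreover have sub: "R \<subseteq> ?V - Y" and "indep ?E R"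
        using R(1) by (simp_all add: max_indep_def)
      ultimately have "max_indep ?E ?V R" unfolding max_indep_def by blast
      then have "R \<inter> Y \<noteq> {}" using hit by (simp add: hits_def)
      then show False using sub by blast
    qed
  qed
  then show ?thesis using assms(2) S R by (simp add: blocking_set_def)
qed

theorem theorem26:
  fixes G :: "'a pair_pre_digraph" and Y :: "'a set"
  assumes "pair_graph G"
    and "blocking_set G Y"
  shows "\<exists>Y' \<subseteq> Y. blocking_set G Y' \<and> card Y' \<le> 2 ^ bd G"
proof -
  interpret pair_graph G by fact
  have Y: "Y \<subseteq> pverts G" using assms(2) by (simp add: blocking_set_def)
  have E: "sym (parcs G)" "irrefl (parcs G)"
    using arcs_symmetric no_loops' by (auto simp: sym_def irrefl_def)
  \<comment> \<open>\<open>G\<close> is its own contraction along the identity, with singleton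
    fibres.\<close>
  have "layered (parcs G) (bd G) (pverts G)"
    using layered_contraction[OF E pair_finite_verts assms(1) contraction_id[OF assms(1)]] .
  moreover have "hits (parcs G) (pverts G) Y"
    using blocking_set_iff_hits assms Y by blast
  ultimately obtain Y' where Y': "Y' \<subseteq> Y" "card Y' \<le> 2 ^ bd G" "hits (parcs G) (pverts G) Y'"
    using layered_hitting_set[OF E(1) pair_finite_verts] by blast
  moreover have "blocking_set G Y'"
    using blocking_set_iff_hits[OF assms(1), of Y'] Y' Y by blast
  ultimately show ?thesis by blast
qed

end
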